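(* Let $s\in\mathbb{N}\cup\{\infty\}$ and let $H(x)\in\boldsymbol{k}[[x]]_s$ be a fixed nonzero series with $\operatorname{ord}H\ge 1$. Then the set $\mathcal{S}(\mathrm{AJ}_s(H))$ of all solutions $\Phi$ of the third Aczél–Jabotinsky formal differential equation $(\mathrm{AJ}_s(H))$ is a group with respect to substitution $\circ$.
   Context: $\boldsymbol{k}$ is a field of characteristic $0$. $\boldsymbol{k}[[x]]_\infty:=\boldsymbol{k}[[x]]$ is the ring of formal power series; for $s\in\mathbb{N}=\{1,2,\dots\}$, $\boldsymbol{k}[[x]]_s=\boldsymbol{k}[[x]]/(x^{s+1})$ is the ring of $s$-truncated series, whose elements are identified with polynomials $\sum_{j=0}^s c_jx^j$, and multiplication and substitution are computed modulo $x^{s+1}$. $\operatorname{ord} f$ is the least index of a nonzero coefficient of $f$. $\Gamma^s=\{f\in\boldsymbol{k}[[x]]_s:\operatorname{ord} f=1\}$ is a group under substitution with identity $x$. For $H\in\boldsymbol{k}[[x]]_s$ with $\operatorname{ord}H\ge1$, the equation $(\mathrm{AJ}_s(H))$ is $$(H\circ\Phi)(x)=\frac{d\Phi}{dx}(x)\cdot H(x),$$ understood modulo $x^{s+1}$ when $s$ is finite (the product is well defined mod $x^{s+1}$ since $\operatorname{ord}H\geq1$), and $\mathcal{S}(\mathrm{AJ}_s(H))$ is the set of all solutions $\Phi\in\Gamma^s$. *)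

theory Defs
  imports
    "HOL-Library.Extended_Nat"
    "HOL-Computational_Algebra.Formal_Power_Series"
    "HOL-Algebra.Group"
begin

(* Reduction modulo x^(s+1): the class of f in k[[x]]/(x^(s+1)) is represented by the
   unique polynomial of degree at most s in it. For s = \<infinity> nothing is cut off. *)
definition fps_trunc :: "enat \<Rightarrow> 'a::zero fps \<Rightarrow> 'a fps" where
  "fps_trunc s f = (case s of enat n \<Rightarrow> fps_cutoff (Suc n) f | \<infinity> \<Rightarrow> f)"

(* The underlying set of k[[x]]_s, as a set of canonical representatives. *)
definition trunc_series :: "enat \<Rightarrow> 'a::zero fps set" where
  "trunc_series s = {f. \<forall>n. s < enat n \<longrightarrow> fps_nth f n = 0}"

(* fps_compose f g is the actual substitution f(g(x)) only if g has constant term 0;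
   below, the inner series always has order 1. *)
definition trunc_compose :: "enat \<Rightarrow> 'a::field_char_0 fps \<Rightarrow> 'a fps \<Rightarrow> 'a fps" where
  "trunc_compose s f g = fps_trunc s (fps_compose f g)"

(* subdegree f = 1 already entails f \<noteq> 0, since the library sets subdegree 0 = 0. *)
definition Gamma :: "enat \<Rightarrow> 'a::field_char_0 fps set" where
  "Gamma s = {f \<in> trunc_series s. subdegree f = 1}"

definition Gamma_group :: "enat \<Rightarrow> 'a::field_char_0 fps monoid" where
  "Gamma_group s = \<lparr>carrier = Gamma s, monoid.mult = trunc_compose s, one = fps_X\<rparr>"

(* For finite s, the derivative of a class modulo x^(s+1) is only determined modulo x^s.
   Since H has order at least 1, the product below is nevertheless determined modulo
   x^(s+1), so using the derivative of the canonical representative loses nothing. *)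
definition AJ :: "enat \<Rightarrow> 'a::field_char_0 fps \<Rightarrow> 'a fps \<Rightarrow> bool" where
  "AJ s H \<Phi> \<longleftrightarrow> trunc_compose s H \<Phi> = fps_trunc s (fps_deriv \<Phi> * H)"

definition AJ_solutions :: "enat \<Rightarrow> 'a::field_char_0 fps \<Rightarrow> 'a fps set" where
  "AJ_solutions s H = {\<Phi> \<in> Gamma s. AJ s H \<Phi>}"

end

theory Submission
  imports Defs
begin

text \<open>
  Composition is associative and compatible with reduction modulo \<open>x\<^sup>s\<^sup>+\<^sup>1\<close>, so every
  computation can be carried out with full power series and read modulo \<open>x\<^sup>s\<^sup>+\<^sup>1\<close>; the
  derivative, which loses one coefficient, only occurs multiplied by \<open>H\<close>, and
  \<open>ord H \<ge> 1\<close> restores it (\<open>fps_trunc_deriv_mult_cong\<close>).  Hence the equation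
  \<open>H \<circ> \<Phi> = \<Phi>' H\<close> makes sense for residue classes (\<open>AJ_cong\<close>), and the group
  structure comes from the chain rule.  The equation says that \<open>\<Phi>\<close> leaves the formal
  vector field \<open>H d/dx\<close> invariant, a property stable under composition and inversion:
  if \<open>\<Phi>\<close> and \<open>\<Psi>\<close> are solutions, then
  \<open>H \<circ> \<Phi> \<circ> \<Psi> = (\<Phi>' \<circ> \<Psi>) (H \<circ> \<Psi>) = (\<Phi>' \<circ> \<Psi>) \<Psi>' H = (\<Phi> \<circ> \<Psi>)' H\<close>
  (\<open>AJ_compose\<close>), and if \<open>\<Psi>\<close> is the compositional inverse of a solution \<open>\<Phi>\<close>, then
  substituting \<open>\<Psi>\<close> into \<open>H \<circ> \<Phi> = \<Phi>' H\<close> and multiplying by \<open>\<Psi>'\<close> gives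
  \<open>\<Psi>' H = \<Psi>' (\<Phi>' \<circ> \<Psi>) (H \<circ> \<Psi>) = H \<circ> \<Psi>\<close> (\<open>AJ_inv\<close>).
\<close>

lemma fps_nth_fps_trunc: "fps_nth (fps_trunc s f) n = (if enat n \<le> s then fps_nth f n else 0)"
  by (cases s) (auto simp: fps_trunc_def)

lemma fps_trunc_eq_iff:
  "fps_trunc s f = fps_trunc s g \<longleftrightarrow> (\<forall>n. enat n \<le> s \<longrightarrow> fps_nth f n = fps_nth g n)"
  by (auto simp: fps_eq_iff fps_nth_fps_trunc)

lemma fps_trunc_idem [simp]: "fps_trunc s (fps_trunc s f) = fps_trunc s f"
  by (simp add: fps_trunc_eq_iff fps_nth_fps_trunc)

lemma fps_trunc_in_trunc_series: "fps_trunc s f \<in> trunc_series s"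
  by (auto simp: trunc_series_def fps_nth_fps_trunc)

lemma fps_trunc_id: "f \<in> trunc_series s \<Longrightarrow> fps_trunc s f = f"
  by (auto simp: trunc_series_def fps_eq_iff fps_nth_fps_trunc not_le)

lemma fps_trunc_mult_cong:
  fixes f g :: "'a::comm_ring_1 fps"
  assumes "fps_trunc s f = fps_trunc s f'" "fps_trunc s g = fps_trunc s g'"
  shows "fps_trunc s (f * g) = fps_trunc s (f' * g')"
  unfolding fps_trunc_eq_iff
proof (intro allI impI)
  fix n assume n: "enat n \<le> s"
  have "enat i \<le> s" if "i \<le> n" for i
    using that n by (meson enat_ord_simps(1) order_trans)
  then show "fps_nth (f * g) n = fps_nth (f' * g') n"
    using assms by (auto simp: fps_mult_nth fps_trunc_eq_iff intro!: sum.cong)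
qed

lemma fps_trunc_power_cong:
  fixes f :: "'a::comm_ring_1 fps"
  assumes "fps_trunc s f = fps_trunc s f'"
  shows "fps_trunc s (f ^ k) = fps_trunc s (f' ^ k)"
  by (induction k) (auto intro: fps_trunc_mult_cong assms)

lemma fps_trunc_compose_cong:
  fixes f g :: "'a::comm_ring_1 fps"
  assumes "fps_trunc s f = fps_trunc s f'" "fps_trunc s g = fps_trunc s g'"
  shows "fps_trunc s (f oo g) = fps_trunc s (f' oo g')"
  unfolding fps_trunc_eq_iff
proof (intro allI impI)
  fix n assume n: "enat n \<le> s"
  have "fps_nth f i = fps_nth f' i" if "i \<le> n" for i
    using that n assms(1) unfolding fps_trunc_eq_iff by (meson enat_ord_simps(1) order_trans)
  moreover have "fps_nth (g ^ i) n = fps_nth (g' ^ i) n" for i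
    using fps_trunc_power_cong[OF assms(2), of i] n unfolding fps_trunc_eq_iff by blast
  ultimately show "fps_nth (f oo g) n = fps_nth (f' oo g') n"
    by (simp add: fps_compose_nth)
qed

text \<open>
  The coefficient of \<open>x\<^sup>n\<close> in \<open>f' h\<close> would involve the coefficient of \<open>x\<^sup>n\<^sup>+\<^sup>1\<close> in \<open>f\<close> only
  through the constant term of \<open>h\<close>.
\<close>
lemma fps_trunc_deriv_mult_cong:
  fixes f g h :: "'a::comm_ring_1 fps"
  assumes "fps_trunc s f = fps_trunc s g" "fps_nth h 0 = 0"
  shows "fps_trunc s (fps_deriv f * h) = fps_trunc s (fps_deriv g * h)"
  unfolding fps_trunc_eq_iff
proof (intro allI impI)
  fix n assume n: "enat n \<le> s"
  have "fps_nth (fps_deriv f) i * fps_nth h (n - i) = fps_nth (fps_deriv g) i * fps_nth h (n - i)"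
    if "i \<le> n" for i
  proof (cases "i = n")
    case False
    then have "enat (Suc i) \<le> s"
      using that n by (meson enat_ord_simps(1) le_neq_implies_less order_trans Suc_leI)
    then show ?thesis using assms(1) by (simp add: fps_trunc_eq_iff)
  qed (simp add: assms(2))
  then show "fps_nth (fps_deriv f * h) n = fps_nth (fps_deriv g * h) n"
    by (auto simp: fps_mult_nth intro!: sum.cong)
qed

lemma AJ_cong:
  assumes "fps_trunc s \<Phi> = fps_trunc s \<Psi>" "fps_nth H 0 = 0"
  shows "AJ s H \<Phi> \<longleftrightarrow> AJ s H \<Psi>"
  using fps_trunc_compose_cong[OF refl assms(1), of H] fps_trunc_deriv_mult_cong[OF assms]
  by (simp add: AJ_def trunc_compose_def)

lemma AJ_fps_trunc: "fps_nth H 0 = 0 \<Longrightarrow> AJ s H (fps_trunc s \<Phi>) \<longleftrightarrow> AJ s H \<Phi>"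
  by (rule AJ_cong) simp_all

text \<open>
  In the chain rule the factor \<open>\<Phi>' \<circ> \<Psi>\<close> comes from the equation for \<open>\<Phi>\<close>, into which \<open>\<Psi>\<close> is
  substituted, and the factor \<open>\<Psi>'\<close> from the equation for \<open>\<Psi>\<close>.
\<close>
lemma AJ_compose:
  assumes "AJ s H \<Phi>" "AJ s H \<Psi>" "fps_nth \<Phi> 0 = 0" "fps_nth \<Psi> 0 = 0"
  shows "AJ s H (\<Phi> oo \<Psi>)"
proof -
  have \<Phi>: "fps_trunc s (H oo \<Phi>) = fps_trunc s (fps_deriv \<Phi> * H)"
    and \<Psi>: "fps_trunc s (H oo \<Psi>) = fps_trunc s (fps_deriv \<Psi> * H)"
    using assms by (simp_all add: AJ_def trunc_compose_def)
  have "fps_trunc s (H oo (\<Phi> oo \<Psi>)) = fps_trunc s ((H oo \<Phi>) oo \<Psi>)"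
    using assms by (simp add: fps_compose_assoc)
  also have "\<dots> = fps_trunc s ((fps_deriv \<Phi> * H) oo \<Psi>)"
    by (rule fps_trunc_compose_cong[OF \<Phi> refl])
  also have "\<dots> = fps_trunc s ((fps_deriv \<Phi> oo \<Psi>) * (H oo \<Psi>))"
    using assms by (simp add: fps_compose_mult_distrib)
  also have "\<dots> = fps_trunc s ((fps_deriv \<Phi> oo \<Psi>) * (fps_deriv \<Psi> * H))"
    by (rule fps_trunc_mult_cong[OF refl \<Psi>])
  also have "\<dots> = fps_trunc s (fps_deriv (\<Phi> oo \<Psi>) * H)"
    using assms by (simp add: fps_compose_deriv mult_ac)
  finally show ?thesis by (simp add: AJ_def trunc_compose_def)
qed

text \<open>
  The law \<open>\<Phi> \<circ> \<Psi> = x\<close> is used twice: it cancels \<open>\<Phi>\<close> inside \<open>H \<circ> \<Phi> \<circ> \<Psi>\<close>, and its derivative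
  \<open>(\<Phi>' \<circ> \<Psi>) \<Psi>' = 1\<close> cancels the factor \<open>\<Phi>' \<circ> \<Psi>\<close>.  The inverse is taken among all power
  series, so that both cancellations are exact.
\<close>
lemma AJ_inv:
  assumes "AJ s H \<Phi>" "\<Phi> oo \<Psi> = fps_X" "fps_nth \<Phi> 0 = 0" "fps_nth \<Psi> 0 = 0"
  shows "AJ s H \<Psi>"
proof -
  have \<Phi>: "fps_trunc s (H oo \<Phi>) = fps_trunc s (fps_deriv \<Phi> * H)"
    using assms by (simp add: AJ_def trunc_compose_def)
  have chain: "(fps_deriv \<Phi> oo \<Psi>) * fps_deriv \<Psi> = 1"
    using fps_compose_deriv[OF assms(4), of \<Phi>] assms(2) by simp
  have "H = (H oo \<Phi>) oo \<Psi>"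
    using fps_compose_assoc[OF assms(4,3), of H] assms(2) by simp
  then have "fps_trunc s H = fps_trunc s ((fps_deriv \<Phi> * H) oo \<Psi>)"
    using fps_trunc_compose_cong[OF \<Phi> refl, of \<Psi>] by simp
  then have "fps_trunc s (fps_deriv \<Psi> * H) = fps_trunc s (fps_deriv \<Psi> * ((fps_deriv \<Phi> * H) oo \<Psi>))"
    by (rule fps_trunc_mult_cong[OF refl])
  also have "fps_deriv \<Psi> * ((fps_deriv \<Phi> * H) oo \<Psi>) = H oo \<Psi>"
  proof -
    have "fps_deriv \<Psi> * ((fps_deriv \<Phi> * H) oo \<Psi>)
        = ((fps_deriv \<Phi> oo \<Psi>) * fps_deriv \<Psi>) * (H oo \<Psi>)"
      using assms by (simp add: fps_compose_mult_distrib mult_ac)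
    then show ?thesis by (simp add: chain)
  qed
  finally show ?thesis by (simp add: AJ_def trunc_compose_def)
qed

lemma subdegree_eq_1_iff:
  fixes f :: "'a::zero fps"
  shows "subdegree f = 1 \<longleftrightarrow> fps_nth f 0 = 0 \<and> fps_nth f 1 \<noteq> 0"
proof
  assume "subdegree f = 1"
  then show "fps_nth f 0 = 0 \<and> fps_nth f 1 \<noteq> 0"
    by (metis nth_less_subdegree_zero nth_subdegree_nonzero subdegree_0 zero_less_one zero_neq_one)
qed (auto intro: subdegreeI)

lemma fps_trunc_in_Gamma_iff:
  "s \<ge> 1 \<Longrightarrow> fps_trunc s f \<in> Gamma s \<longleftrightarrow> fps_nth f 0 = 0 \<and> fps_nth f 1 \<noteq> 0"
  by (simp add: Gamma_def subdegree_eq_1_iff fps_trunc_in_trunc_series fps_nth_fps_trunc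
      del: One_nat_def flip: one_enat_def zero_enat_def)

lemma fps_trunc_in_AJ_solutions_iff:
  assumes "s \<ge> 1" "fps_nth H 0 = 0"
  shows "fps_trunc s \<Phi> \<in> AJ_solutions s H \<longleftrightarrow>
    fps_nth \<Phi> 0 = 0 \<and> fps_nth \<Phi> 1 \<noteq> 0 \<and> AJ s H \<Phi>"
  using assms by (simp add: AJ_solutions_def fps_trunc_in_Gamma_iff AJ_fps_trunc)

lemma AJ_solutionsD:
  assumes "\<Phi> \<in> AJ_solutions s H"
  shows "fps_nth \<Phi> 0 = 0" "fps_nth \<Phi> 1 \<noteq> 0" "AJ s H \<Phi>" "fps_trunc s \<Phi> = \<Phi>"
  using assms by (simp_all add: AJ_solutions_def Gamma_def subdegree_eq_1_iff fps_trunc_id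
      del: One_nat_def)

lemma fps_trunc_fps_X: "s \<ge> 1 \<Longrightarrow> fps_trunc s fps_X = fps_X"
  by (auto simp: fps_eq_iff fps_nth_fps_trunc one_enat_def)

lemma trunc_compose_fps_trunc_left:
  "trunc_compose s (fps_trunc s f) g = trunc_compose s f g"
  unfolding trunc_compose_def by (rule fps_trunc_compose_cong) simp_all

lemma trunc_compose_fps_trunc_right:
  "trunc_compose s f (fps_trunc s g) = trunc_compose s f g"
  unfolding trunc_compose_def by (rule fps_trunc_compose_cong) simp_all

lemma trunc_compose_assoc:
  assumes "fps_nth g 0 = 0" "fps_nth h 0 = 0"
  shows "trunc_compose s (trunc_compose s f g) h = trunc_compose s f (trunc_compose s g h)"
proof -
  have "trunc_compose s (trunc_compose s f g) h = trunc_compose s (f oo g) h"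
    using trunc_compose_fps_trunc_left[of s "f oo g" h] by (simp add: trunc_compose_def)
  also have "\<dots> = trunc_compose s f (g oo h)"
    using assms by (simp add: trunc_compose_def fps_compose_assoc)
  also have "\<dots> = trunc_compose s f (trunc_compose s g h)"
    using trunc_compose_fps_trunc_right[of s f "g oo h"] by (simp add: trunc_compose_def)
  finally show ?thesis .
qed

lemma fps_X_in_AJ_solutions:
  assumes "s \<ge> 1" "fps_nth H 0 = 0"
  shows "fps_X \<in> AJ_solutions s H"
proof -
  have "fps_trunc s fps_X \<in> AJ_solutions s H"
    unfolding fps_trunc_in_AJ_solutions_iff[OF assms] by (simp add: AJ_def trunc_compose_def)
  then show ?thesis using assms by (simp add: fps_trunc_fps_X)
qed

theorem fact1:
  fixes s :: enat and H :: "'a::field_char_0 fps"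
  assumes "s \<ge> 1"
    and "H \<in> trunc_series s"
    and "H \<noteq> 0"
    and "subdegree H \<ge> 1"
  shows "group (Gamma_group s \<lparr>carrier := AJ_solutions s H\<rparr>)"
proof -
  have H0: "fps_nth H 0 = 0"
    using assms(4) by (intro nth_less_subdegree_zero) simp
  note mem_iff = fps_trunc_in_AJ_solutions_iff[OF assms(1) H0]
  show ?thesis
  proof (rule groupI, simp_all add: Gamma_group_def)
    fix \<Phi> \<Psi> assume "\<Phi> \<in> AJ_solutions s H" "\<Psi> \<in> AJ_solutions s H"
    note \<Phi> = AJ_solutionsD[OF this(1)] and \<Psi> = AJ_solutionsD[OF this(2)]
    have "fps_nth (\<Phi> oo \<Psi>) 1 = fps_nth \<Phi> 1 * fps_nth \<Psi> 1"
      by (simp add: fps_compose_nth)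
    then show "trunc_compose s \<Phi> \<Psi> \<in> AJ_solutions s H"
      using \<Phi> \<Psi> by (simp add: trunc_compose_def mem_iff AJ_compose)
  next
    show "fps_X \<in> AJ_solutions s H" by (rule fps_X_in_AJ_solutions[OF assms(1) H0])
  next
    fix \<Phi> \<Psi> \<Theta>
    assume "\<Phi> \<in> AJ_solutions s H" "\<Psi> \<in> AJ_solutions s H" "\<Theta> \<in> AJ_solutions s H"
    then show "trunc_compose s (trunc_compose s \<Phi> \<Psi>) \<Theta> = trunc_compose s \<Phi> (trunc_compose s \<Psi> \<Theta>)"
      by (intro trunc_compose_assoc AJ_solutionsD(1))
  next
    fix \<Phi> assume "\<Phi> \<in> AJ_solutions s H"
    then show "trunc_compose s fps_X \<Phi> = \<Phi>"
      by (simp add: trunc_compose_def AJ_solutionsD)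
  next
    fix \<Phi> assume "\<Phi> \<in> AJ_solutions s H"
    note \<Phi> = AJ_solutionsD[OF this]
    define \<Psi> where "\<Psi> = fps_inv \<Phi>"
    have inv: "\<Psi> oo \<Phi> = fps_X" "\<Phi> oo \<Psi> = fps_X"
      using \<Phi> by (simp_all add: \<Psi>_def fps_inv fps_inv_right)
    have \<Psi>0: "fps_nth \<Psi> 0 = 0"
      by (simp add: \<Psi>_def fps_inv_def)
    have "fps_nth \<Phi> 1 * fps_nth \<Psi> 1 = fps_nth (\<Phi> oo \<Psi>) 1"
      by (simp add: fps_compose_nth)
    then have "fps_nth \<Psi> 1 \<noteq> 0"
      by (auto simp: inv)
    note \<Psi> = \<Psi>0 this
    have "AJ s H \<Psi>"
      by (rule AJ_inv[OF \<Phi>(3) inv(2) \<Phi>(1) \<Psi>(1)])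
    then have "fps_trunc s \<Psi> \<in> AJ_solutions s H"
      using \<Psi> by (simp add: mem_iff)
    moreover have "trunc_compose s (fps_trunc s \<Psi>) \<Phi> = fps_X"
      unfolding trunc_compose_fps_trunc_left
      using inv assms(1) by (simp add: trunc_compose_def fps_trunc_fps_X)
    ultimately show "\<exists>\<Psi>\<in>AJ_solutions s H. trunc_compose s \<Psi> \<Phi> = fps_X" by blast
  qed
qed

end
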